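(* Let $X$ be a locally convex space and $Y$ be a complete metrizable topological vector space. Consider a point $x \in X$, an affine mapping $A: X \to Y$ with $x \in \mathrm{dom}\, A$ and $A(x) \in \mathrm{core}\, A(X)$, and a sequence $(K_p)_{p\in\mathbb{N}}$ of convex subsets of $\mathrm{dom}\, A$ such that $$K_\infty := \mathrm{dom}\, A = \bigcup_{p \in \mathbb{N}} K_p \quad \mbox{and} \quad x \in K_p \subset K_{p+1} \quad \mbox{for each } p \in \mathbb{N}.$$ Let $\alpha \in (0,1]$ and let $U$ be a neighborhood of $x$ in $x + \alpha(K_\infty-x)$. Then there exists a $q \in \mathbb{N}$ such that the set $\overline{A\big(U\cap (x+ \alpha (K_{p} - x))\big)}$ is a neighborhood of $A(x)$ in $Y$ for each $p \in \{q, q+1, \dots\}$. If, in addition, for such an index $p$ the set $U\cap K_{p}$ is bounded, then for each neighborhood $W$ of $x$ in $x+ \alpha (K_{p} - x)$ the set $\overline{A(W)}$ is a neighborhood of $A(x)$ in $Y$.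
   Context: Topological vector spaces are real and Hausdorff; a locally convex space is a topological vector space in which every neighborhood of the origin contains a convex neighborhood of the origin. $\overline{C}$ denotes the closure of $C$. Neighborhoods of $x$ in a subset of $X$ are taken with respect to the relative topology. A mapping $A:X\to Y$ (possibly defined only on a subset $\mathrm{dom}\,A$ of $X$) is affine if $\mathrm{dom}\,A$ is convex and $A(\lambda u+(1-\lambda)x)=\lambda A(u)+(1-\lambda)A(x)$ for each $u,x\in\mathrm{dom}\,A$ and each $\lambda\in[0,1]$. $A(X)$ denotes the range $A(\mathrm{dom}\,A)$. A subset $C$ of a vector space $Y$ is absorbing if for every $y\in Y$ there is a $\delta>0$ such that $\lambda y\in C$ for each $\lambda\in(-\delta,\delta)$; $\mathrm{core}\,C:=\{y\in C:\ C-y\mbox{ is absorbing}\}$. *)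

theory Defs
  imports "HOL-Analysis.Analysis"
begin

class real_tvs = real_vector + t2_space + topological_ab_group_add +
  assumes tendsto_scaleR_Pair:
    "((\<lambda>p. fst p *\<^sub>R snd p) \<longlongrightarrow> c *\<^sub>R x) (nhds c \<times>\<^sub>F nhds x)"

text \<open>The polymorphic constant \<^const>\<open>convex\<close> is not available inside a class specification, so
  convexity of \<open>C\<close> is spelled out; see \<open>locally_convex\<close> below.\<close>

class locally_convex_space = real_tvs +
  assumes locally_convex_raw:
    "open V \<Longrightarrow> 0 \<in> V \<Longrightarrow>
      \<exists>C W. (\<forall>x\<in>C. \<forall>y\<in>C. \<forall>u\<ge>0. \<forall>v\<ge>0. u + v = 1 \<longrightarrow> u *\<^sub>R x + v *\<^sub>R y \<in> C) \<and>
            open W \<and> 0 \<in> W \<and> W \<subseteq> C \<and> C \<subseteq> V"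

lemma locally_convex:
  fixes V :: "'a::locally_convex_space set"
  assumes "open V" "0 \<in> V"
  shows "\<exists>C. convex C \<and> 0 \<in> interior C \<and> C \<subseteq> V"
  using locally_convex_raw[OF assms] unfolding convex_def by (meson interiorI)

text \<open>Uniform continuity of addition and negation forces the uniformity of this class to be the
  canonical one (see \<open>complete_tvs_uniformity\<close>); so completeness means that every filter that is
  Cauchy in the sense of topological vector spaces converges.\<close>

class complete_tvs = real_tvs + uniform_topological_group_add + complete_uniform_space

lemma complete_tvs_uniformity:
  "eventually P (uniformity :: ('a::complete_tvs \<times> 'a) filter) \<longleftrightarrow>
    (\<exists>V. open V \<and> 0 \<in> V \<and> (\<forall>x y. y - x \<in> V \<longrightarrow> P (x, y)))"
proof
  assume P: "eventually P (uniformity :: ('a \<times> 'a) filter)"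
  obtain Q where Q: "eventually Q uniformity" "\<And>a b c. Q (a, b) \<Longrightarrow> P (a + c, b + c)"
    using uniformity_of_uniform_continuous_invariant[OF uniformly_continuous_add' P] by metis
  from Q(1) have "eventually (\<lambda>y. Q (0, y)) (nhds 0)"
    unfolding eventually_nhds_uniformity by (rule eventually_mono) auto
  then obtain V where V: "open V" "0 \<in> V" "\<And>y. y \<in> V \<Longrightarrow> Q (0, y)"
    unfolding eventually_nhds by blast
  have "P (x, y)" if "y - x \<in> V" for x y
    using Q(2)[OF V(3)[OF that], of x] by simp
  with V show "\<exists>V. open V \<and> 0 \<in> V \<and> (\<forall>x y. y - x \<in> V \<longrightarrow> P (x, y))"
    by blast
next
  assume "\<exists>V. open V \<and> 0 \<in> V \<and> (\<forall>x y. y - x \<in> V \<longrightarrow> P (x, y))"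
  then obtain V where V: "open V" "(0::'a) \<in> V" "\<And>x y. y - x \<in> V \<Longrightarrow> P (x, y)" by blast
  have "eventually (\<lambda>y. y \<in> V) (nhds 0)" using V by (meson eventually_nhds)
  then have E: "eventually (\<lambda>(x', y). x' = 0 \<longrightarrow> y \<in> V) (uniformity :: ('a \<times> 'a) filter)"
    unfolding eventually_nhds_uniformity .
  obtain Q where Q: "eventually Q (uniformity :: ('a \<times> 'a) filter)"
      "\<And>a b c. Q (a, b) \<Longrightarrow> (\<lambda>(x', y). x' = 0 \<longrightarrow> y \<in> V) (a + c, b + c)"
    using uniformity_of_uniform_continuous_invariant[OF uniformly_continuous_add' E] by metis
  show "eventually P (uniformity :: ('a \<times> 'a) filter)"
    using Q(1)
  proof (rule eventually_mono)
    fix z assume "Q z"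
    then show "P z" using Q(2)[of "fst z" "snd z" "- fst z"] V(3)[of "snd z" "fst z"] by simp
  qed
qed

definition nbhd_in :: "'a::topological_space set \<Rightarrow> 'a \<Rightarrow> 'a set \<Rightarrow> bool"
  where "nbhd_in S x N \<longleftrightarrow>
    N \<subseteq> S \<and> (\<exists>T. openin (top_of_set S) T \<and> x \<in> T \<and> T \<subseteq> N)"

text \<open>A map with domain \<open>D\<close> is a total function, whose values outside \<open>D\<close> are irrelevant.\<close>

definition affine_map_on :: "'a::real_vector set \<Rightarrow> ('a \<Rightarrow> 'b::real_vector) \<Rightarrow> bool"
  where "affine_map_on D A \<longleftrightarrow> convex D \<and>
    (\<forall>u\<in>D. \<forall>x\<in>D. \<forall>t\<in>{0..1}.
      A (t *\<^sub>R u + (1 - t) *\<^sub>R x) = t *\<^sub>R A u + (1 - t) *\<^sub>R A x)"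

definition absorbing :: "'a::real_vector set \<Rightarrow> bool"
  where "absorbing C \<longleftrightarrow> (\<forall>y. \<exists>\<delta>>0. \<forall>t\<in>{-\<delta><..<\<delta>}. t *\<^sub>R y \<in> C)"

definition alg_core :: "'a::real_vector set \<Rightarrow> 'a set"
  where "alg_core C = {y \<in> C. absorbing ((\<lambda>c. c - y) ` C)}"

definition scale_about :: "'a::real_vector \<Rightarrow> real \<Rightarrow> 'a set \<Rightarrow> 'a set"
  where "scale_about x \<alpha> K = (\<lambda>k. x + \<alpha> *\<^sub>R (k - x)) ` K"

text \<open>Boundedness in the sense of von Neumann; the library's \<^const>\<open>bounded\<close> is metric.\<close>

definition tvs_bounded :: "'a::real_tvs set \<Rightarrow> bool"
  where "tvs_bounded B \<longleftrightarrow>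
    (\<forall>V. open V \<longrightarrow> 0 \<in> V \<longrightarrow> (\<exists>s>0. \<forall>t>s. B \<subseteq> (*\<^sub>R) t ` V))"

end

theory Submission
  imports Defs
begin

text \<open>
  Shrink \<open>U\<close> to \<open>(x + \<alpha>(K\<^sub>\<infinity> - x)) \<inter> (x + C)\<close> with \<open>C\<close> a convex neighbourhood of \<open>0\<close>. The sets
  \<open>S\<^sub>p\<close>, obtained by translating the images of \<open>(x + \<alpha>(K\<^sub>p - x)) \<inter> (x + C)\<close> by \<open>- A x\<close>, are
  convex, increasing and contain \<open>0\<close>, and their union is absorbing because \<open>C\<close> is absorbing and
  \<open>A x\<close> is in the core of the range. Hence the multiples \<open>n S\<^sub>n\<close> cover the space, and by Baire's
  theorem some closure of \<open>S\<^sub>m\<close> has an interior point \<open>y\<close>. A negative multiple of \<open>y\<close> lies in some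
  \<open>S\<^sub>n\<close>, so convexity makes \<open>0\<close> an interior point of the closure of \<open>S\<^sub>p\<close> for all large \<open>p\<close>. In the
  bounded case a homothety with centre \<open>x\<close> maps \<open>U \<inter> (x + \<alpha>(K\<^sub>p - x))\<close> into \<open>W\<close>.
\<close>

section \<open>Affinities and small neighbourhoods in topological vector spaces\<close>

lemma tendsto_scaleR_tvs:
  fixes g :: "'c \<Rightarrow> 'a::real_tvs"
  assumes "(f \<longlongrightarrow> c) F" and "(g \<longlongrightarrow> x) F"
  shows "((\<lambda>i. f i *\<^sub>R g i) \<longlongrightarrow> c *\<^sub>R x) F"
proof -
  have "filterlim (\<lambda>i. (f i, g i)) (nhds c \<times>\<^sub>F nhds x) F"
    using assms by (rule filterlim_Pair)
  from filterlim_compose[OF tendsto_scaleR_Pair this] show ?thesis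
    by simp
qed

lemma continuous_on_affinity_tvs:
  "continuous_on S (\<lambda>v::'a::real_tvs. a + c *\<^sub>R v)"
  unfolding continuous_on_def
  by (intro ballI tendsto_add tendsto_scaleR_tvs tendsto_const tendsto_ident_at)

lemma open_affinity_tvs:
  fixes V :: "'a::real_tvs set"
  assumes "open V" and "c \<noteq> 0"
  shows "open ((\<lambda>v. a + c *\<^sub>R v) ` V)"
proof -
  let ?g = "\<lambda>w. (- (1/c) *\<^sub>R a) + (1/c) *\<^sub>R w"
  have "(\<lambda>v. a + c *\<^sub>R v) ` V = ?g -` V"
  proof (intro equalityI subsetI)
    fix w assume "w \<in> ?g -` V"
    moreover have "w = a + c *\<^sub>R ?g w"
      using assms(2) by (simp add: algebra_simps)
    ultimately show "w \<in> (\<lambda>v. a + c *\<^sub>R v) ` V" by blast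
  qed (use assms(2) in \<open>auto simp: algebra_simps\<close>)
  then show ?thesis
    by (metis open_vimage[OF assms(1) continuous_on_affinity_tvs])
qed

lemma open_translation_tvs: "open V \<Longrightarrow> open ((+) a ` V)" for a :: "'a::real_tvs"
  using open_affinity_tvs[of V 1 a] by simp

text \<open>An affinity with nonzero ratio is a homeomorphism. Asking only for an inclusion in
  \<open>T\<close> lets one lemma cover rescaling, translation, convex combination with a fixed
  point and contraction towards a point.\<close>

lemma interior_closure_affinity:
  fixes S :: "'a::real_tvs set"
  assumes "y \<in> interior (closure S)" and "c \<noteq> 0"
    and "(\<lambda>v. a + c *\<^sub>R v) ` S \<subseteq> T"
  shows "a + c *\<^sub>R y \<in> interior (closure T)"
proof (rule interiorI)
  let ?f = "\<lambda>v. a + c *\<^sub>R v"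
  show "open (?f ` interior (closure S))"
    using assms(2) by (intro open_affinity_tvs) auto
  have "?f ` closure S \<subseteq> closure T"
    by (rule image_closure_subset[OF continuous_on_affinity_tvs])
      (use assms(3) closure_subset in auto)
  then show "?f ` interior (closure S) \<subseteq> closure T"
    using interior_subset by fast
qed (use assms(1) in auto)

text \<open>This is continuity of subtraction at the origin, with one neighbourhood serving both
  arguments.\<close>

lemma small_differences:
  fixes V :: "'a::real_tvs set"
  assumes "open V" and "0 \<in> V"
  obtains H where "open H" and "0 \<in> H" and "\<forall>a\<in>H. \<forall>b\<in>H. b - a \<in> V"
proof -
  have "((\<lambda>p. snd p - fst p) \<longlongrightarrow> 0 - 0) (nhds (0::'a) \<times>\<^sub>F nhds 0)"
    by (intro tendsto_diff filterlim_fst filterlim_snd)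
  then have "eventually (\<lambda>p. snd p - fst p \<in> V) (nhds 0 \<times>\<^sub>F nhds 0)"
    using assms by (auto dest: topological_tendstoD)
  then obtain P Q where "eventually P (nhds 0)" "eventually Q (nhds 0)"
    and PQ: "\<And>a b. P a \<Longrightarrow> Q b \<Longrightarrow> b - a \<in> V"
    unfolding eventually_prod_filter by auto
  then have "eventually (\<lambda>a. P a \<and> Q a) (nhds 0)"
    by (simp add: eventually_conj_iff)
  then obtain H where "open H" "0 \<in> H" "\<And>a. a \<in> H \<Longrightarrow> P a \<and> Q a"
    unfolding eventually_nhds by blast
  then show ?thesis using PQ by (intro that[of H]) auto
qed

text \<open>Regularity of the space together with a smallness condition: the inductive step of the
  Baire construction.\<close>

lemma open_tvs_shrink:
  fixes G V :: "'a::real_tvs set"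
  assumes "open G" and "z \<in> G" and "open V" and "0 \<in> V"
  obtains H where "open H" and "z \<in> H" and "closure H \<subseteq> G"
    and "\<forall>a\<in>H. \<forall>b\<in>H. b - a \<in> V"
proof -
  \<comment> \<open>One set \<open>V'\<close> controls both demands: differences in \<open>V\<close>
    give smallness, differences in \<open>G - z\<close> keep the closure inside
    \<open>G\<close>.\<close>
  define V' where "V' = V \<inter> (+) (- z) ` G"
  have "open V'"
    unfolding V'_def by (intro open_Int open_translation_tvs assms)
  moreover have "0 \<in> V'"
    using assms(2,4) by (auto simp: V'_def)
  ultimately obtain H where H: "open H" "0 \<in> H" "\<forall>a\<in>H. \<forall>b\<in>H. b - a \<in> V'"
    by (rule small_differences)
  show ?thesis
  proof
    show "open ((+) z ` H)" using H(1) by (rule open_translation_tvs)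
    show "z \<in> (+) z ` H" using H(2) by (auto intro: rev_image_eqI)
    show "\<forall>a\<in>(+) z ` H. \<forall>b\<in>(+) z ` H. b - a \<in> V"
      using H(3) by (auto simp: V'_def)
    show "closure ((+) z ` H) \<subseteq> G"
    proof
      fix w assume w: "w \<in> closure ((+) z ` H)"
      have "open ((+) w ` H)" "w \<in> (+) w ` H"
        using open_translation_tvs[OF H(1)] H(2) by (auto intro: rev_image_eqI)
      \<comment> \<open>A point of the closure has its neighbourhood \<open>w + H\<close> meeting
        \<open>z + H\<close>, so \<open>w - z\<close> is a difference of two points of
        \<open>H\<close>.\<close>
      with w have "(+) w ` H \<inter> (+) z ` H \<noteq> {}"
        by (metis closure_iff_nhds_not_empty order_refl inf_commute)
      then obtain a b where "a \<in> H" "b \<in> H" and eq: "w + a = z + b" by auto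
      then have "b - a \<in> (+) (- z) ` G" using H(3) by (auto simp: V'_def)
      moreover from eq have "w = z + (b - a)" by (simp add: algebra_simps)
      ultimately show "w \<in> G" by auto
    qed
  qed
qed

section \<open>Baire's theorem and its consequence for increasing convex sets\<close>

text \<open>Metrizability does not make the metric of the topology complete, so the library's Baire theorem
  does not apply; the nested sets below are Cauchy for the uniformity instead.\<close>

lemma Baire_complete_tvs:
  fixes F :: "nat \<Rightarrow> 'a::complete_tvs set"
  assumes "metrizable_space (euclidean :: 'a topology)"
    and closed: "\<And>n. closed (F n)" and cover: "(\<Union>n. F n) = UNIV"
  obtains n where "interior (F n) \<noteq> {}"
proof (rule ccontr)
  assume "\<not> thesis"
  with that have empty: "\<And>n. interior (F n) = {}" by blast
  obtain d where "Metric_space (UNIV::'a set) d"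
    and eucl: "euclidean = Metric_space.mtopology (UNIV::'a set) d"
    using assms(1) unfolding metrizable_space_def
    by (metis Metric_space.topspace_mtopology topspace_euclidean)
  then interpret M: Metric_space "UNIV::'a set" d by simp
  \<comment> \<open>The metric enters only through these balls, a countable base of neighbourhoods
    of 0; it need not be translation invariant.\<close>
  define V where "V n = M.mball 0 (1 / Suc n)" for n
  have V_open: "open (V n)" and V_0: "0 \<in> V n" for n
    using M.openin_mball eucl by (auto simp: V_def open_openin)
  have V_base: "\<exists>n. V n \<subseteq> W" if W: "open W" "0 \<in> W" for W
  proof -
    have "openin M.mtopology W"
      using W(1) unfolding open_openin eucl .
    then obtain r where "r > 0" "M.mball 0 r \<subseteq> W"
      using W(2) unfolding M.openin_mtopology by blast
    moreover obtain n where "1 / Suc n < r"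
      using \<open>r > 0\<close> nat_approx_posE by blast
    ultimately show ?thesis unfolding V_def by (meson M.mball_subset_concentric less_imp_le order_trans)
  qed
  \<comment> \<open>Nested open sets: stage \<open>Suc n\<close> avoids \<open>F n\<close> even
    after closure and is small of order \<open>V n\<close>.\<close>
  have "\<exists>G. \<forall>n. (open (G n) \<and> G n \<noteq> {}) \<and>
    (closure (G (Suc n)) \<subseteq> G n - F n \<and> (\<forall>a\<in>G (Suc n). \<forall>b\<in>G (Suc n). b - a \<in> V n))"
  proof (rule dependent_nat_choice)
    fix G :: "'a set" and n assume G: "open G \<and> G \<noteq> {}"
    then have "\<not> G \<subseteq> F n"
      using empty interior_maximal by blast
    then obtain z where "z \<in> G - F n" by blast
    moreover have "open (G - F n)" using G closed by blast
    ultimately show "\<exists>G'. (open G' \<and> G' \<noteq> {}) \<and> closure G' \<subseteq> G - F n \<and>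
        (\<forall>a\<in>G'. \<forall>b\<in>G'. b - a \<in> V n)"
      using open_tvs_shrink[OF _ _ V_open[of n] V_0[of n]] by (metis empty_iff)
  qed (auto intro: exI[of _ UNIV])
  then obtain G where G_all: "\<forall>n. (open (G n) \<and> G n \<noteq> {}) \<and>
    (closure (G (Suc n)) \<subseteq> G n - F n \<and> (\<forall>a\<in>G (Suc n). \<forall>b\<in>G (Suc n). b - a \<in> V n))"
    by (rule exE)
  have G: "G n \<noteq> {}" "closure (G (Suc n)) \<subseteq> G n - F n"
    "a \<in> G (Suc n) \<Longrightarrow> b \<in> G (Suc n) \<Longrightarrow> b - a \<in> V n" for n a b
    using spec[OF G_all, of n] by simp_all
  have dec: "G n \<subseteq> G m" if "m \<le> n" for m n
    using that by (rule lift_Suc_antimono_le[rotated]) (use G(2) closure_subset in blast)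
  define y where "y n = (SOME z. z \<in> G n)" for n
  have y: "y n \<in> G n" for n
    using G(1) by (simp add: y_def some_in_eq)
  have "Cauchy y"
    unfolding Cauchy_uniform_iff
  proof (intro allI impI)
    fix P assume "eventually P (uniformity :: ('a \<times> 'a) filter)"
    then obtain W where W: "open W" "0 \<in> W" "\<And>a b. b - a \<in> W \<Longrightarrow> P (a, b)"
      unfolding complete_tvs_uniformity by blast
    then obtain n where "V n \<subseteq> W" using V_base by blast
    \<comment> \<open>\<open>N = Suc n\<close> works: from there on all terms lie in
      \<open>G (Suc n)\<close>, whose differences lie in \<open>V n\<close>.\<close>
    then show "\<exists>N. \<forall>n\<ge>N. \<forall>m\<ge>N. P (y n, y m)"
      using W(3) G(3) y dec by (meson in_mono)
  qed
  then obtain l where l: "y \<longlonglongrightarrow> l"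
    using cauchy_filter_convergent[of "filtermap y sequentially"]
    by (auto simp: Cauchy_uniform convergent_filter.simps filterlim_def)
  \<comment> \<open>The limit lies in the closure of every \<open>G (Suc n)\<close>, which is
    disjoint from \<open>F n\<close>.\<close>
  have "l \<notin> F n" for n
  proof -
    have "l \<in> closure (G (Suc n))"
    proof (rule Lim_in_closed_set[OF closed_closure _ _ l])
      show "eventually (\<lambda>i. y i \<in> closure (G (Suc n))) sequentially"
        unfolding eventually_sequentially using y dec closure_subset by blast
    qed simp
    then show ?thesis using G(2) by blast
  qed
  with cover show False by blast
qed

lemma absorbing_UN_convex_imp_interior_closure:
  fixes S :: "nat \<Rightarrow> 'a::complete_tvs set"
  assumes "metrizable_space (euclidean :: 'a topology)"
    and conv: "\<And>p. convex (S p)" and zero: "\<And>p. 0 \<in> S p" and inc: "\<And>p. S p \<subseteq> S (Suc p)"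
    and abs: "absorbing (\<Union>p. S p)"
  shows "\<exists>q. \<forall>p\<ge>q. 0 \<in> interior (closure (S p))"
proof -
  have mono: "S p \<subseteq> S q" if "p \<le> q" for p q
    using that inc by (rule lift_Suc_mono_le[rotated])
  have shrink: "t *\<^sub>R s \<in> S p" if "s \<in> S p" "0 \<le> t" "t \<le> 1" for s t p
    using convexD[OF conv that(1) zero, of t "1 - t"] that by simp
  have reach: "\<exists>n. (1 / real (Suc n)) *\<^sub>R y \<in> S n" for y
  proof -
    obtain e where e: "e > 0" "\<forall>t\<in>{-e<..<e}. t *\<^sub>R y \<in> (\<Union>p. S p)"
      using abs[unfolded absorbing_def] by metis
    obtain m where m: "1 / real (Suc m) < e"
      using e(1) nat_approx_posE by blast
    then have "1 / real (Suc m) \<in> {-e<..<e}"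
      using e(1) by (auto intro: order.strict_trans[of _ 0])
    then obtain p where p: "(1 / real (Suc m)) *\<^sub>R y \<in> S p" using e(2) by blast
    \<comment> \<open>A single index must serve as scaling factor and as index of the set. Enlarging
      both to the maximum is harmless: the extra factor is at most 1, and \<open>S\<close>
      increases.\<close>
    define n where "n = max m p"
    have "(real (Suc m) / real (Suc n)) *\<^sub>R (1 / real (Suc m)) *\<^sub>R y \<in> S n"
      by (rule shrink) (use p mono[of p n] in \<open>auto simp: n_def\<close>)
    moreover have "(real (Suc m) / real (Suc n)) *\<^sub>R (1 / real (Suc m)) *\<^sub>R y = (1 / real (Suc n)) *\<^sub>R y"
      by (simp del: of_nat_Suc)
    ultimately show ?thesis by metis
  qed
  define F where "F n = closure ((*\<^sub>R) (real (Suc n)) ` S n)" for n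
  have "y \<in> (\<Union>n. F n)" for y
  proof -
    obtain n where "(1 / real (Suc n)) *\<^sub>R y \<in> S n" using reach by blast
    then have "real (Suc n) *\<^sub>R (1 / real (Suc n)) *\<^sub>R y \<in> F n"
      unfolding F_def by (intro subsetD[OF closure_subset] imageI)
    moreover have "real (Suc n) *\<^sub>R (1 / real (Suc n)) *\<^sub>R y = y"
      by (simp del: of_nat_Suc)
    ultimately show ?thesis by (metis UN_I UNIV_I)
  qed
  then have "(\<Union>n. F n) = UNIV" by blast
  moreover have "closed (F n)" for n
    by (simp add: F_def)
  ultimately obtain m where "interior (F m) \<noteq> {}"
    using Baire_complete_tvs[OF assms(1)] by metis
  then obtain y0 where "y0 \<in> interior (closure ((*\<^sub>R) (real (Suc m)) ` S m))"
    unfolding F_def by blast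
  \<comment> \<open>This undoes the scaling in \<open>F m\<close>; the leading 0 is the translation
    part of the affinity.\<close>
  then have "0 + (1 / real (Suc m)) *\<^sub>R y0 \<in> interior (closure (S m))"
    by (rule interior_closure_affinity) (auto simp del: of_nat_Suc)
  then obtain y where y: "y \<in> interior (closure (S m))" by (rule that)
  obtain n where n: "(1 / real (Suc n)) *\<^sub>R (- y) \<in> S n" using reach by blast
  define z where "z = (1 / real (Suc n)) *\<^sub>R (- y)"
  \<comment> \<open>Since \<open>real (Suc n)\<close> times \<open>z\<close> is \<open>- y\<close>,
    weights in the ratio \<open>real (Suc n)\<close> to 1 on \<open>z\<close> and \<open>y\<close>
    balance to 0; \<open>t\<close> is the normalised weight of \<open>y\<close>.\<close>
  define t where "t = 1 / (1 + real (Suc n))"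
  have t: "0 < t" "t \<le> 1" by (auto simp: t_def)
  have comb: "(1 - t) *\<^sub>R z + t *\<^sub>R y = 0"
  proof -
    have "1 + real (Suc n) \<noteq> 0" by linarith
    then have "1 - t = t * real (Suc n)"
      unfolding t_def by (simp add: diff_divide_eq_iff del: of_nat_Suc)
    then have "(1 - t) *\<^sub>R z = t *\<^sub>R (- y)"
      by (simp add: z_def del: of_nat_Suc)
    then show ?thesis by simp
  qed
  have "0 \<in> interior (closure (S p))" if p: "p \<ge> max m n" for p
  proof -
    have "y \<in> interior (closure (S p))"
      using p by (intro subsetD[OF interior_mono[OF closure_mono[OF mono]] y]) simp
    moreover have "z \<in> S p"
      using n mono[of n p] p unfolding z_def by auto
    \<comment> \<open>By convexity the contraction towards \<open>z\<close> maps \<open>S p\<close>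
      into itself, and it sends the interior point \<open>y\<close> to 0.\<close>
    then have "(\<lambda>v. (1 - t) *\<^sub>R z + t *\<^sub>R v) ` S p \<subseteq> S p"
      using t by (auto intro!: convexD[OF conv])
    ultimately show ?thesis
      using interior_closure_affinity[of y "S p" t "(1 - t) *\<^sub>R z" "S p"] t comb by simp
  qed
  then show ?thesis by blast
qed

section \<open>Absorbing sets, affine maps and homotheties\<close>

text \<open>Negative factors come from applying the hypothesis to \<open>- y\<close>. The one-sided
  form suits convex sets, which are stable under homotheties with ratio in [0,1].\<close>

lemma absorbingI_nonneg:
  assumes "\<And>y. \<exists>\<delta>>0. \<forall>t. 0 \<le> t \<and> t < \<delta> \<longrightarrow> t *\<^sub>R y \<in> C"
  shows "absorbing C"
  unfolding absorbing_def
proof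
  fix y
  obtain a where a: "a > 0" "\<And>t. 0 \<le> t \<Longrightarrow> t < a \<Longrightarrow> t *\<^sub>R y \<in> C"
    using assms[of y] by blast
  obtain b where b: "b > 0" "\<And>t. 0 \<le> t \<Longrightarrow> t < b \<Longrightarrow> t *\<^sub>R (- y) \<in> C"
    using assms[of "- y"] by blast
  have "t *\<^sub>R y \<in> C" if "t \<in> {-min a b<..<min a b}" for t
    using a(2)[of t] b(2)[of "- t"] that by (cases "t \<ge> 0") auto
  with a(1) b(1) show "\<exists>\<delta>>0. \<forall>t\<in>{-\<delta><..<\<delta>}. t *\<^sub>R y \<in> C"
    by (intro exI[of _ "min a b"]) auto
qed

lemma nhds_0_tvs_absorbs:
  fixes u :: "'a::real_tvs"
  assumes "0 \<in> interior C"
  obtains r where "r > 0" and "\<And>s. 0 \<le> s \<Longrightarrow> s < r \<Longrightarrow> s *\<^sub>R u \<in> C"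
proof -
  have "((\<lambda>s. s *\<^sub>R u) \<longlongrightarrow> 0 *\<^sub>R u) (nhds 0)"
    by (intro tendsto_scaleR_tvs filterlim_ident tendsto_const)
  then have "eventually (\<lambda>s. s *\<^sub>R u \<in> interior C) (nhds 0)"
    using assms by (auto dest: topological_tendstoD)
  then obtain r where r: "r > 0" "\<And>s. dist s 0 < r \<Longrightarrow> s *\<^sub>R u \<in> interior C"
    unfolding eventually_nhds_metric by blast
  show ?thesis
    using r by (intro that[of r] subsetD[OF interior_subset[of C]]) (auto simp: dist_real_def)
qed

lemma nbhd_in_UNIV_iff: "nbhd_in UNIV y N \<longleftrightarrow> y \<in> interior N"
  by (auto simp: nbhd_in_def interior_def)

lemma nbhd_in_obtain_open:
  assumes "nbhd_in S x N"
  obtains T where "open T" and "x \<in> T" and "S \<inter> T \<subseteq> N"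
  using assms unfolding nbhd_in_def openin_open by blast

lemma affine_map_on_affinity:
  assumes "affine_map_on D A" and "x \<in> D" and "u \<in> D" and "0 \<le> t" and "t \<le> 1"
  shows "A (x + t *\<^sub>R (u - x)) = A x + t *\<^sub>R (A u - A x)"
proof -
  have "A (t *\<^sub>R u + (1 - t) *\<^sub>R x) = t *\<^sub>R A u + (1 - t) *\<^sub>R A x"
    using assms unfolding affine_map_on_def by auto
  then show ?thesis by (simp add: algebra_simps)
qed

lemma convex_affine_map_image:
  assumes "affine_map_on D A" and "convex S" and "S \<subseteq> D"
  shows "convex (A ` S)"
proof (rule convexI)
  fix v w and s t :: real
  assume "v \<in> A ` S" "w \<in> A ` S" and st: "0 \<le> s" "0 \<le> t" "s + t = 1"
  then obtain a b where ab: "a \<in> S" "b \<in> S" "v = A a" "w = A b" by blast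
  have "t = 1 - s" "s \<in> {0..1}" using st by auto
  then have "A (s *\<^sub>R a + t *\<^sub>R b) = s *\<^sub>R v + t *\<^sub>R w"
    using assms(1,3) ab unfolding affine_map_on_def by blast
  moreover have "s *\<^sub>R a + t *\<^sub>R b \<in> S"
    using convexD[OF assms(2)] ab st by blast
  ultimately show "s *\<^sub>R v + t *\<^sub>R w \<in> A ` S" by (metis imageI)
qed

lemma convex_scale_about:
  assumes "convex K"
  shows "convex (scale_about x \<alpha> K)"
proof -
  have "scale_about x \<alpha> K = (\<lambda>k. (x - \<alpha> *\<^sub>R x) + \<alpha> *\<^sub>R k) ` K"
    by (auto simp: scale_about_def algebra_simps)
  then show ?thesis using convex_affinity[OF assms] by metis
qed

lemma scale_about_mono: "K \<subseteq> L \<Longrightarrow> scale_about x \<alpha> K \<subseteq> scale_about x \<alpha> L"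
  by (auto simp: scale_about_def)

lemma homothety_mem_convex:
  assumes "convex K" and "x \<in> K" and "u \<in> K" and "0 \<le> t" and "t \<le> 1"
  shows "x + t *\<^sub>R (u - x) \<in> K"
  using convexD[OF assms(1,3,2), of t "1 - t"] assms(4,5) by (simp add: algebra_simps)

lemma centre_mem_scale_about: "x \<in> K \<Longrightarrow> x \<in> scale_about x \<alpha> K"
  by (force simp: scale_about_def)

lemma scale_about_subset:
  assumes "convex K" and "x \<in> K" and "0 \<le> \<alpha>" and "\<alpha> \<le> 1"
  shows "scale_about x \<alpha> K \<subseteq> K"
  using homothety_mem_convex[OF assms(1,2) _ assms(3,4)] by (auto simp: scale_about_def)

text \<open>The ratio \<open>s\<close> factors as \<open>s / \<alpha>\<close>, which stays in
  \<open>K\<close> by convexity, followed by \<open>\<alpha>\<close>.\<close>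

lemma homothety_mem_scale_about:
  assumes "convex K" and "x \<in> K" and "u \<in> K" and "0 \<le> s" and "s \<le> \<alpha>" and "0 < \<alpha>"
  shows "x + s *\<^sub>R (u - x) \<in> scale_about x \<alpha> K"
proof -
  have "x + (s / \<alpha>) *\<^sub>R (u - x) \<in> K"
    using assms by (intro homothety_mem_convex) auto
  then have "x + \<alpha> *\<^sub>R ((x + (s / \<alpha>) *\<^sub>R (u - x)) - x) \<in> scale_about x \<alpha> K"
    unfolding scale_about_def by blast
  then show ?thesis using assms(6) by simp
qed

text \<open>Boundedness scales about the origin, but the contraction is centred at \<open>x\<close>.
  As \<open>x\<close> is in \<open>B\<close>, both \<open>x\<close> and \<open>u\<close> lie in one
  multiple \<open>r H\<close>, so \<open>(u - x) / r\<close> is a difference of points of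
  \<open>H\<close>.\<close>

lemma tvs_bounded_homothety:
  fixes B :: "'a::real_tvs set"
  assumes "tvs_bounded B" and "x \<in> B" and "open T" and "x \<in> T"
  obtains t where "0 < t" and "t \<le> 1" and "\<And>u. u \<in> B \<Longrightarrow> x + t *\<^sub>R (u - x) \<in> T"
proof -
  let ?V = "(+) (- x) ` T"
  have "open ?V" using assms(3) by (rule open_translation_tvs)
  moreover have "0 \<in> ?V" using assms(4) by auto
  ultimately obtain H where H: "open H" "0 \<in> H" "\<forall>a\<in>H. \<forall>b\<in>H. b - a \<in> ?V"
    by (rule small_differences)
  then obtain s where s: "s > 0" "\<And>t. t > s \<Longrightarrow> B \<subseteq> (*\<^sub>R) t ` H"
    using assms(1) unfolding tvs_bounded_def by blast
  define r where "r = s + 1"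
  have r: "r > s" "r \<ge> 1" using s(1) by (auto simp: r_def)
  show ?thesis
  proof
    fix u assume "u \<in> B"
    then obtain a b where "a \<in> H" "b \<in> H" "x = r *\<^sub>R a" "u = r *\<^sub>R b"
      using s(2)[OF r(1)] assms(2) by blast
    then have "(1 / r) *\<^sub>R (u - x) = b - a"
      using r(2) by (simp add: algebra_simps)
    moreover have "b - a \<in> ?V" using H(3) \<open>a \<in> H\<close> \<open>b \<in> H\<close> by blast
    then have "x + (b - a) \<in> T" by auto
    ultimately show "x + (1 / r) *\<^sub>R (u - x) \<in> T" by simp
  qed (use r in auto)
qed

section \<open>Near-openness of \<open>A\<close> at \<open>x\<close>\<close>

theorem proposition6p5:
  fixes A :: "'a::locally_convex_space \<Rightarrow> 'b::complete_tvs"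
    and domA :: "'a set"
    and x :: 'a
    and K :: "nat \<Rightarrow> 'a set"
    and \<alpha> :: real
    and U :: "'a set"
  assumes "metrizable_space (euclidean :: 'b topology)"
    and "affine_map_on domA A"
    and "x \<in> domA"
    and "A x \<in> alg_core (A ` domA)"
    and "\<And>p. convex (K p)"
    and "domA = (\<Union>p. K p)"
    and "\<And>p. x \<in> K p"
    and "\<And>p. K p \<subseteq> K (Suc p)"
    and "0 < \<alpha>" and "\<alpha> \<le> 1"
    and "nbhd_in (scale_about x \<alpha> domA) x U"
  shows "\<exists>q. \<forall>p\<ge>q.
    nbhd_in UNIV (A x) (closure (A ` (U \<inter> scale_about x \<alpha> (K p)))) \<and>
    (tvs_bounded (U \<inter> K p) \<longrightarrow>
      (\<forall>W. nbhd_in (scale_about x \<alpha> (K p)) x W \<longrightarrow> nbhd_in UNIV (A x) (closure (A ` W))))"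
proof -
  have KD: "K p \<subseteq> domA" for p using assms(6) by blast
  have sub: "scale_about x \<alpha> (K p) \<subseteq> K p" for p
    using scale_about_subset assms(5,7,9,10) by (metis less_imp_le)
  obtain T where T: "open T" "x \<in> T" "scale_about x \<alpha> domA \<inter> T \<subseteq> U"
    using assms(11) by (rule nbhd_in_obtain_open)
  have "open ((+) (- x) ` T)" using T(1) by (rule open_translation_tvs)
  moreover have "0 \<in> (+) (- x) ` T" using T(2) by auto
  ultimately obtain C where C: "convex C" "0 \<in> interior C" "C \<subseteq> (+) (- x) ` T"
    using locally_convex by blast
  define E where "E p = scale_about x \<alpha> (K p) \<inter> (+) x ` C" for p
  define S where "S p = (\<lambda>v. v - A x) ` A ` E p" for p
  have E_sub: "E p \<subseteq> U \<inter> scale_about x \<alpha> (K p)" for p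
    using scale_about_mono[OF KD] C(3) T(3) by (fastforce simp: E_def)
  have "\<exists>q. \<forall>p\<ge>q. 0 \<in> interior (closure (S p))"
  proof (rule absorbing_UN_convex_imp_interior_closure[OF assms(1)])
    fix p
    have "convex (E p)"
      unfolding E_def using assms(5) C(1)
      by (intro convex_Int convex_scale_about convex_translation)
    moreover have "E p \<subseteq> domA" using sub KD by (auto simp: E_def)
    ultimately show "convex (S p)"
      unfolding S_def
      by (intro convex_translation_subtract convex_affine_map_image[OF assms(2)])
    have "x \<in> E p"
      using centre_mem_scale_about[OF assms(7)] C(2) interior_subset
      by (force simp: E_def)
    then show "0 \<in> S p" by (force simp: S_def)
    show "S p \<subseteq> S (Suc p)"
      using scale_about_mono[OF assms(8)] unfolding S_def E_def by blast
  next
    show "absorbing (\<Union>p. S p)"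
    proof (rule absorbingI_nonneg)
      fix y
      have "absorbing ((\<lambda>c. c - A x) ` A ` domA)"
        using assms(4) by (simp add: alg_core_def)
      then obtain e where e: "e > 0"
        "\<forall>t\<in>{-e<..<e}. t *\<^sub>R y \<in> (\<lambda>c. c - A x) ` A ` domA"
        unfolding absorbing_def by metis
      \<comment> \<open>Half of \<open>e\<close> lies strictly inside the open interval; the
        resulting \<open>d\<close> gives a direction \<open>d - x\<close> that \<open>A\<close> maps
        onto a positive multiple of \<open>y\<close>.\<close>
      have "(e / 2) *\<^sub>R y \<in> (\<lambda>c. c - A x) ` A ` domA" using e by auto
      then obtain d where d: "d \<in> domA" "(e / 2) *\<^sub>R y = A d - A x" by blast
      then obtain p where p: "d \<in> K p" using assms(6) by blast
      obtain r where r: "r > 0" "\<And>s. 0 \<le> s \<Longrightarrow> s < r \<Longrightarrow> s *\<^sub>R (d - x) \<in> C"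
        using C(2) by (rule nhds_0_tvs_absorbs) blast
      \<comment> \<open>Moving from \<open>x\<close> by the fraction \<open>s\<close> towards
        \<open>d\<close> must stay in \<open>x + C\<close>, hence \<open>s < r\<close>, and in the
        scaled set, hence \<open>s \<le> \<alpha>\<close>. The bound on \<open>t\<close> expresses
        both.\<close>
      have "t *\<^sub>R y \<in> (\<Union>p. S p)" if t: "0 \<le> t" "t < min r \<alpha> * (e / 2)" for t
      proof -
        define s where "s = t / (e / 2)"
        have s: "0 \<le> s" "s < r" "s \<le> \<alpha>"
          using t e(1) pos_divide_less_eq[of "e/2" t "min r \<alpha>"] by (auto simp: s_def)
        have "x + s *\<^sub>R (d - x) \<in> E p"
          using homothety_mem_scale_about[OF assms(5,7) p s(1,3) assms(9)] r(2)[OF s(1,2)]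
          by (auto simp: E_def)
        moreover have "A (x + s *\<^sub>R (d - x)) = A x + s *\<^sub>R (A d - A x)"
          using s assms(10) by (intro affine_map_on_affinity[OF assms(2,3) d(1)]) auto
        moreover have "s *\<^sub>R (A d - A x) = t *\<^sub>R y"
          using e(1) by (simp add: s_def flip: d(2))
        ultimately have "t *\<^sub>R y \<in> S p"
          unfolding S_def image_image by (intro image_eqI) auto
        then show ?thesis by blast
      qed
      moreover have "min r \<alpha> * (e / 2) > 0" using r(1) e(1) assms(9) by simp
      ultimately show "\<exists>\<delta>>0. \<forall>t. 0 \<le> t \<and> t < \<delta> \<longrightarrow> t *\<^sub>R y \<in> (\<Union>p. S p)" by blast
    qed
  qed
  then obtain q where q: "\<And>p. p \<ge> q \<Longrightarrow> 0 \<in> interior (closure (S p))" by blast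
  have main: "A x \<in> interior (closure (A ` (U \<inter> scale_about x \<alpha> (K p))))" if "p \<ge> q" for p
  proof -
    have "(\<lambda>v. A x + 1 *\<^sub>R v) ` S p = A ` E p"
      by (simp add: S_def image_image)
    then have "(\<lambda>v. A x + 1 *\<^sub>R v) ` S p \<subseteq> A ` (U \<inter> scale_about x \<alpha> (K p))"
      using image_mono[OF E_sub] by simp
    from interior_closure_affinity[OF q[OF that] _ this] show ?thesis by simp
  qed
  have "A x \<in> interior (closure (A ` W))"
    if p: "p \<ge> q" and bdd: "tvs_bounded (U \<inter> K p)" and W: "nbhd_in (scale_about x \<alpha> (K p)) x W"
    for p W
  proof -
    obtain O' where O': "open O'" "x \<in> O'" "scale_about x \<alpha> (K p) \<inter> O' \<subseteq> W"
      using W by (rule nbhd_in_obtain_open)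
    have "x \<in> U" using assms(11) by (auto simp: nbhd_in_def)
    then obtain t where t: "0 < t" "t \<le> 1" "\<And>u. u \<in> U \<inter> K p \<Longrightarrow> x + t *\<^sub>R (u - x) \<in> O'"
      using tvs_bounded_homothety[OF bdd _ O'(1,2)] assms(7) by blast
    have "(\<lambda>v. (A x - t *\<^sub>R A x) + t *\<^sub>R v) ` A ` (U \<inter> scale_about x \<alpha> (K p)) \<subseteq> A ` W"
    proof clarify
      fix u assume u: "u \<in> U" "u \<in> scale_about x \<alpha> (K p)"
      have "x + t *\<^sub>R (u - x) \<in> scale_about x \<alpha> (K p)"
        using u t assms(5,7)
        by (intro homothety_mem_convex convex_scale_about centre_mem_scale_about) auto
      \<comment> \<open>The choice of \<open>t\<close> concerns points of
        \<open>U \<inter> K p\<close>; \<open>sub\<close> puts \<open>u\<close> there.\<close>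
      then have "x + t *\<^sub>R (u - x) \<in> W"
        using O'(3) t(3) u sub by blast
      moreover have "A (x + t *\<^sub>R (u - x)) = (A x - t *\<^sub>R A x) + t *\<^sub>R A u"
        using affine_map_on_affinity[OF assms(2,3), of u t] u sub KD t
        by (auto simp: algebra_simps)
      ultimately show "(A x - t *\<^sub>R A x) + t *\<^sub>R A u \<in> A ` W" by (metis imageI)
    qed
    from interior_closure_affinity[OF main[OF p] _ this] t(1) show ?thesis by simp
  qed
  with main show ?thesis unfolding nbhd_in_UNIV_iff by blast
qed

end
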